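(* There exist real nilpotent Lie algebras $\mathfrak{n}$ with $\phi_{\mathfrak{n}}\ne 0$ and the following properties (one such algebra for each of (i), (ii)): (i) $\dim\mathfrak{n}=13$, $\mathfrak{n}$ is $5$-step nilpotent, $\dim\mathfrak{z}(\mathfrak{n})=3$, $\operatorname{rank}(\mathfrak{n})=1$ and, with respect to some basis of $\mathfrak{n}$, $$D=\operatorname{diag}(1,2,3,4,5,6,7,-1,-2,-3,-4,-5,1)\in\operatorname{Der}(\mathfrak{n}),\qquad D|_{\mathfrak{z}(\mathfrak{n})}=\operatorname{diag}(7,-5,1).$$ (ii) $\dim\mathfrak{n}=17$, $\mathfrak{n}$ is $5$-step nilpotent, $\dim\mathfrak{z}(\mathfrak{n})=4$, $\operatorname{rank}(\mathfrak{n})=1$ and, with respect to some basis of $\mathfrak{n}$, $$D=\operatorname{diag}(-1,-2,-3,-4,-5,-6,-7,1,2,3,4,5,6,7,-1,2,1)\in\operatorname{Der}(\mathfrak{n}),$$ $$D|_{\mathfrak{z}(\mathfrak{n})}=\operatorname{diag}(-7,7,-1,1),\qquad \operatorname{tr}D=2.$$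
   Context: $\mathfrak{z}(\mathfrak{n})$ is the center of $\mathfrak{n}$; the matrix of $D|_{\mathfrak{z}(\mathfrak{n})}$ is with respect to a suitable basis of $\mathfrak{z}(\mathfrak{n})$. A derivation is real semisimple if it is diagonalizable over $\mathbb{R}$. A maximal torus of derivations of $\mathfrak{n}$ is a maximal abelian subspace of real semisimple derivations; it is unique up to conjugation by automorphisms, and its dimension is denoted $\operatorname{rank}(\mathfrak{n})$. $\phi_{\mathfrak{n}}$ denotes the pre-Einstein derivation of $\mathfrak{n}$: a real semisimple derivation, unique up to conjugation by automorphisms, such that $\operatorname{tr}(\phi_{\mathfrak{n}}D)=\operatorname{tr}D$ for all $D\in\operatorname{Der}(\mathfrak{n})$. One has $\phi_{\mathfrak{n}}\ne 0$ if and only if $\mathfrak{n}$ has a derivation with nonzero trace. *)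

theory Defs
  imports "HOL-Analysis.Analysis"
begin

text \<open>
  A real Lie algebra of dimension \<open>n\<close> is a bracket on \<open>real ^ 'n\<close> with \<open>CARD('n) = n\<close>; up to
  isomorphism every such Lie algebra is of this form. Endomorphisms are square matrices acting
  by \<open>(*v)\<close>, so that they form a real vector space of type \<open>real ^ 'n ^ 'n\<close>, to which \<open>subspace\<close>,
  \<open>dim\<close> and \<open>trace\<close> apply.
\<close>

type_synonym 'n bracket = "real ^ 'n \<Rightarrow> real ^ 'n \<Rightarrow> real ^ 'n"

definition lie_algebra :: "'n::finite bracket \<Rightarrow> bool" where
  "lie_algebra br \<longleftrightarrow>
     bilinear br \<and>
     (\<forall>x. br x x = 0) \<and>
     (\<forall>x y z. br x (br y z) + br y (br z x) + br z (br x y) = 0)"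

definition lie_center :: "'n::finite bracket \<Rightarrow> (real ^ 'n) set" where
  "lie_center br = {z. \<forall>x. br z x = 0}"

primrec lower_central_series :: "'n::finite bracket \<Rightarrow> nat \<Rightarrow> (real ^ 'n) set" where
  "lower_central_series br 0 = UNIV"
| "lower_central_series br (Suc k) = span {br x y | x y. y \<in> lower_central_series br k}"

text \<open>The step is normalised so that a nonzero abelian Lie algebra is 1-step nilpotent.\<close>

definition step_nilpotent :: "nat \<Rightarrow> 'n::finite bracket \<Rightarrow> bool" where
  "step_nilpotent k br \<longleftrightarrow>
     lower_central_series br k = {0} \<and> (\<forall>j<k. lower_central_series br j \<noteq> {0})"

definition Der :: "'n::finite bracket \<Rightarrow> (real ^ 'n ^ 'n) set" where
  "Der br = {A. \<forall>x y. A *v br x y = br (A *v x) y + br x (A *v y)}"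

text \<open>
  \<open>diagonal_on V A ds\<close>: the subspace \<open>V\<close> is invariant under \<open>A\<close>, and \<open>diag(ds)\<close> is the matrix
  of the restriction of \<open>A\<close> to \<open>V\<close> with respect to some ordered basis of \<open>V\<close>.
\<close>

definition diagonal_on :: "(real ^ 'n) set \<Rightarrow> real ^ 'n ^ 'n::finite \<Rightarrow> real list \<Rightarrow> bool" where
  "diagonal_on V A ds \<longleftrightarrow>
     (\<exists>bs. length bs = length ds \<and> distinct bs \<and> independent (set bs) \<and> span (set bs) = V \<and>
           (\<forall>i<length ds. A *v (bs ! i) = (ds ! i) *\<^sub>R (bs ! i)))"

definition real_semisimple :: "real ^ 'n ^ 'n::finite \<Rightarrow> bool" where
  "real_semisimple A \<longleftrightarrow> (\<exists>ds. diagonal_on UNIV A ds)"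

definition torus :: "'n::finite bracket \<Rightarrow> (real ^ 'n ^ 'n) set \<Rightarrow> bool" where
  "torus br T \<longleftrightarrow>
     subspace T \<and> T \<subseteq> Der br \<and> (\<forall>A\<in>T. real_semisimple A) \<and> (\<forall>A\<in>T. \<forall>B\<in>T. A ** B = B ** A)"

definition maximal_torus :: "'n::finite bracket \<Rightarrow> (real ^ 'n ^ 'n) set \<Rightarrow> bool" where
  "maximal_torus br T \<longleftrightarrow> torus br T \<and> (\<forall>T'. torus br T' \<and> T \<subseteq> T' \<longrightarrow> T' = T)"

text \<open>
  The common dimension of all maximal tori, which is well defined because maximal tori are
  conjugate under automorphisms. Without such uniqueness the description \<open>THE r\<close> is unspecified.
\<close>

definition lie_rank :: "'n::finite bracket \<Rightarrow> nat" where
  "lie_rank br = (THE r. \<exists>T. maximal_torus br T \<and> dim T = r)"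

text \<open>
  Pre-Einstein derivations are unique only up to conjugation by automorphisms, hence a predicate.
\<close>

definition pre_einstein :: "'n::finite bracket \<Rightarrow> real ^ 'n ^ 'n \<Rightarrow> bool" where
  "pre_einstein br \<phi> \<longleftrightarrow>
     \<phi> \<in> Der br \<and> real_semisimple \<phi> \<and> (\<forall>D\<in>Der br. trace (\<phi> ** D) = trace D)"

text \<open>
  The pre-Einstein derivation is nonzero. Being zero is invariant under conjugation, so this does
  not depend on the chosen representative; existence is stated separately to exclude vacuity.
\<close>

definition pre_einstein_nonzero :: "'n::finite bracket \<Rightarrow> bool" where
  "pre_einstein_nonzero br \<longleftrightarrow>
     (\<exists>\<phi>. pre_einstein br \<phi>) \<and> (\<forall>\<phi>. pre_einstein br \<phi> \<longrightarrow> \<phi> \<noteq> 0)"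

end

theory Submission
  imports Defs
begin

text \<open>
  Both algebras have a basis of eigenvectors of \<open>D\<close> in which every nonzero bracket of two basis
  vectors is, up to sign, again a basis vector. Reading off coefficients of the derivation identity
  shows that every derivation acts on \<open>\<nn>/[\<nn>,\<nn>]\<close> as \<open>c D\<close> for a scalar \<open>c\<close>, and has
  the same diagonal entries as \<open>c D\<close>. A semisimple derivation \<open>A\<close> of trace zero therefore maps
  \<open>\<nn>\<close> into \<open>[\<nn>,\<nn>]\<close>; its eigenvectors for nonzero eigenvalues lie in \<open>[\<nn>,\<nn>]\<close>, so the
  subalgebra \<open>ker A\<close> generates \<open>\<nn>\<close> modulo \<open>[\<nn>,\<nn>]\<close>, which by nilpotency forces
  \<open>ker A = \<nn>\<close>. Hence the trace is injective on every torus, every maximal torus is a line,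
  and a multiple of \<open>D\<close> is a nonzero pre-Einstein derivation.
\<close>

section \<open>Lie algebras with a nice basis\<close>

text \<open>A triple \<open>(i, j, k)\<close> stands for [e_i, e_j] = e_k. Antisymmetry is built in,
  so each pair is listed once and its order carries the sign. A list, rather than a table of
  structure constants, lets the simplifier evaluate concrete brackets entry by entry.\<close>

definition nice_bracket :: "('n \<times> 'n \<times> 'n) list \<Rightarrow> 'n::finite bracket" where
  "nice_bracket L x y = (\<Sum>(i, j, k)\<leftarrow>L. (x $ i * y $ j - x $ j * y $ i) *\<^sub>R axis k 1)"

lemma nice_bracket_Nil [simp]: "nice_bracket [] x y = 0"
  by (simp add: nice_bracket_def)

lemma nice_bracket_Cons [simp]:
  "nice_bracket ((i, j, k) # L) x y =
    (x $ i * y $ j - x $ j * y $ i) *\<^sub>R axis k 1 + nice_bracket L x y"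
  by (simp add: nice_bracket_def)

lemma bilinear_nice_bracket: "bilinear (nice_bracket L)"
proof (induction L)
  case Nil
  then show ?case by (simp add: bilinear_def linear_iff)
next
  case (Cons t L)
  then show ?case
    by (cases t) (auto simp: bilinear_def linear_iff algebra_simps)
qed

lemma nice_bracket_self [simp]: "nice_bracket L x x = 0"
  by (induction L) auto

lemma lie_algebra_nice_bracketI:
  assumes "\<And>x y z. nice_bracket L x (nice_bracket L y z) + nice_bracket L y (nice_bracket L z x)
                    + nice_bracket L z (nice_bracket L x y) = 0"
  shows "lie_algebra (nice_bracket L)"
  using assms by (simp add: lie_algebra_def bilinear_nice_bracket)

section \<open>Coordinate subspaces and the lower central series\<close>

definition coord_subspace :: "'n set \<Rightarrow> (real ^ 'n::finite) set" where
  "coord_subspace S = {x. \<forall>i. i \<notin> S \<longrightarrow> x $ i = 0}"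

lemma coord_subspace_eq_span: "coord_subspace S = span ((\<lambda>i. axis i 1) ` S)"
proof
  show "coord_subspace S \<subseteq> span ((\<lambda>i. axis i 1) ` S)"
  proof
    fix x assume x: "x \<in> coord_subspace S"
    have "x = (\<Sum>i\<in>UNIV. x $ i *\<^sub>R axis i 1)"
      by (simp add: basis_expansion scalar_mult_eq_scaleR [symmetric])
    also have "\<dots> \<in> span ((\<lambda>i. axis i 1) ` S)"
    proof (rule span_sum)
      fix i
      show "x $ i *\<^sub>R axis i 1 \<in> span ((\<lambda>i. axis i 1) ` S)"
        using x by (cases "i \<in> S") (auto simp: coord_subspace_def span_base span_mul span_zero)
    qed
    finally show "x \<in> span ((\<lambda>i. axis i 1) ` S)" .
  qed
  have "subspace (coord_subspace S)"
    by (auto simp: subspace_def coord_subspace_def)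
  then show "span ((\<lambda>i. axis i 1) ` S) \<subseteq> coord_subspace S"
    by (intro span_minimal) (auto simp: coord_subspace_def axis_def)
qed

lemma coord_subspace_eq_0_iff: "coord_subspace S = {0} \<longleftrightarrow> S = {}"
proof
  assume *: "coord_subspace S = {0}"
  have "axis i 1 \<in> coord_subspace S" if "i \<in> S" for i
    using that by (auto simp: coord_subspace_def axis_def)
  with * show "S = {}" by auto
qed (auto simp: coord_subspace_def vec_eq_iff)

text \<open>This excludes several entries for one pair, whose terms would add up or cancel. Unlike
  in the usual notion of a nice basis, two entries may share a source index and the target; this
  occurs in dimension 17.\<close>

definition nice :: "('n::finite \<times> 'n \<times> 'n) list \<Rightarrow> bool" where
  "nice L \<longleftrightarrow> (\<forall>(i, j, k)\<in>set L. nice_bracket L (axis i 1) (axis j 1) = axis k (1 :: real))"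

primrec lcs_support :: "('n \<times> 'n \<times> 'n) list \<Rightarrow> nat \<Rightarrow> 'n set" where
  "lcs_support L 0 = UNIV"
| "lcs_support L (Suc m) =
    set (map (\<lambda>(i, j, k). k) (filter (\<lambda>(i, j, k). i \<in> lcs_support L m \<or> j \<in> lcs_support L m) L))"

lemma nice_bracket_commute: "nice_bracket L y x = - nice_bracket L x y"
  by (induction L) (auto simp: algebra_simps)

text \<open>The induction shortens \<open>L'\<close> while the support stays that of the whole list
  \<open>L\<close>. For a target outside it, both source indices avoid \<open>S\<close>, so the
  relevant coordinates of \<open>y\<close> vanish.\<close>

lemma nice_bracket_in_coord_subspace:
  assumes "y \<in> coord_subspace S" "set L' \<subseteq> set L"
  shows "nice_bracket L' x y \<in>
    coord_subspace (set (map (\<lambda>(i, j, k). k) (filter (\<lambda>(i, j, k). i \<in> S \<or> j \<in> S) L)))"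
  using assms(2)
proof (induction L')
  case Nil
  then show ?case by (simp add: coord_subspace_def)
next
  case (Cons t L')
  obtain i j k where t: "t = (i, j, k)" by (cases t)
  let ?T = "set (map (\<lambda>(i, j, k). k) (filter (\<lambda>(i, j, k). i \<in> S \<or> j \<in> S) L))"
  have "x $ i * y $ j - x $ j * y $ i = 0" if "k \<notin> ?T"
  proof -
    have "i \<notin> S" "j \<notin> S" using that Cons.prems t by force+
    then show ?thesis using assms(1) by (simp add: coord_subspace_def)
  qed
  then have "(x $ i * y $ j - x $ j * y $ i) *\<^sub>R axis k 1 \<in> coord_subspace ?T"
    by (auto simp: coord_subspace_def axis_def simp del: set_map set_filter)
  then show ?case using Cons
    by (auto simp: t coord_subspace_def simp del: set_map set_filter)
qed

text \<open>Niceness makes each supported basis vector a single bracket up to sign, so the upper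
  bound by coordinate subspaces is attained and the series is computed combinatorially.\<close>

lemma lower_central_series_nice:
  assumes "nice L"
  shows "lower_central_series (nice_bracket L) m = coord_subspace (lcs_support L m)"
proof (induction m)
  case 0
  then show ?case by (auto simp: coord_subspace_def)
next
  case (Suc m)
  let ?B = "{nice_bracket L x y | x y. y \<in> coord_subspace (lcs_support L m)}"
  have "subspace (coord_subspace (lcs_support L (Suc m)))"
    by (auto simp: subspace_def coord_subspace_def)
  then have "span ?B \<subseteq> coord_subspace (lcs_support L (Suc m))"
    by (intro span_minimal) (auto dest: nice_bracket_in_coord_subspace[of _ _ L L])
  moreover have "axis k 1 \<in> span ?B" if "k \<in> lcs_support L (Suc m)" for k
  proof -
    from that obtain i j where t: "(i, j, k) \<in> set L"
      and ij: "i \<in> lcs_support L m \<or> j \<in> lcs_support L m"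
      by auto
    have ijk: "nice_bracket L (axis i 1) (axis j 1) = axis k 1"
      using assms t by (auto simp: nice_def)
    have ax: "axis l 1 \<in> coord_subspace (lcs_support L m)" if "l \<in> lcs_support L m" for l
      using that by (auto simp: coord_subspace_def axis_def)
    from ij show ?thesis
    proof
      assume "i \<in> lcs_support L m"
      \<comment> \<open>The series sits in the second slot of the bracket, so here the pair is
        flipped and the result is -e_k.\<close>
      then have "nice_bracket L (axis j 1) (axis i 1) \<in> span ?B"
        using ax by (intro span_base) blast
      then show ?thesis
        using ijk nice_bracket_commute[of L "axis j 1" "axis i 1"] span_neg by fastforce
    next
      assume "j \<in> lcs_support L m"
      then show ?thesis
        using ax ijk by (intro span_base CollectI exI[of _ "axis i 1"] exI[of _ "axis j 1"]) simp
    qed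
  qed
  then have "coord_subspace (lcs_support L (Suc m)) \<subseteq> span ?B"
    unfolding coord_subspace_eq_span[of "lcs_support L (Suc m)"]
    by (intro span_minimal image_subsetI subspace_span)
  ultimately show ?case using Suc by simp
qed

lemma lcs_support_eq_empty_mono:
  "i \<le> j \<Longrightarrow> lcs_support L i = {} \<Longrightarrow> lcs_support L j = {}"
  by (induction j rule: dec_induct) (auto simp: case_prod_unfold)

text \<open>Supports stay empty once empty, so a nonempty support at stage \<open>m\<close> excludes
  all earlier vanishing.\<close>

lemma step_nilpotent_nice:
  assumes "nice L" "lcs_support L (Suc m) = {}" "lcs_support L m \<noteq> {}"
  shows "step_nilpotent (Suc m) (nice_bracket L)"
  using assms lcs_support_eq_empty_mono[of _ m L]
  by (auto simp: step_nilpotent_def lower_central_series_nice coord_subspace_eq_0_iff less_Suc_eq_le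
      simp del: lcs_support.simps lower_central_series.simps)

section \<open>Diagonal derivations\<close>

definition diag :: "('n \<Rightarrow> real) \<Rightarrow> real ^ 'n ^ 'n::finite" where
  "diag d = (\<chi> i j. if i = j then d i else 0)"

lemma diag_mult_vec: "diag d *v x = (\<chi> i. d i * x $ i)"
  by (simp add: diag_def matrix_vector_mult_def vec_eq_iff if_distrib[of "\<lambda>c. c * _"] cong: if_cong)

lemma trace_diag: "trace (diag d) = sum d UNIV"
  by (simp add: trace_def diag_def)

lemma trace_diag_mult: "trace (diag d ** A) = (\<Sum>i\<in>UNIV. d i * A $ i $ i)"
  by (simp add: trace_def diag_def matrix_matrix_mult_def if_distrib[of "\<lambda>c. c * _"] cong: if_cong)

lemma diagonal_on_coord_subspace:
  assumes "distinct is"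
  shows "diagonal_on (coord_subspace (set is)) (diag d) (map d is)"
proof -
  have inj: "inj (\<lambda>i::'a. axis i (1::real))"
    by (auto simp: inj_def axis_eq_axis)
  let ?bs = "map (\<lambda>i. axis i (1::real)) is"
  have "independent (set ?bs)"
    by (rule independent_mono[OF independent_Basis]) (auto simp: Basis_vec_def)
  moreover have "distinct ?bs"
    using assms inj by (simp add: distinct_map inj_on_def inj_def)
  moreover have "span (set ?bs) = coord_subspace (set is)"
    by (simp add: coord_subspace_eq_span)
  moreover have "diag d *v axis i 1 = d i *\<^sub>R axis i 1" for i
    by (simp add: diag_mult_vec vec_eq_iff axis_def)
  ultimately show ?thesis
    unfolding diagonal_on_def by (intro exI[of _ ?bs]) simp
qed

lemma dim_diagonal_on: "diagonal_on V A ds \<Longrightarrow> dim V = length ds"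
  unfolding diagonal_on_def
  by (metis dim_eq_card_independent dim_span distinct_card)

lemma real_semisimple_diag: "real_semisimple (diag d)"
proof -
  obtain "is" where "distinct is" "set is = (UNIV :: 'a set)"
    using finite_distinct_list[OF finite] by blast
  moreover have "coord_subspace (UNIV :: 'a set) = UNIV"
    by (simp add: coord_subspace_def)
  ultimately show ?thesis
    using diagonal_on_coord_subspace[of "is" d] by (auto simp: real_semisimple_def)
qed

lemma diag_in_Der:
  assumes "\<forall>(i, j, k)\<in>set L. d k = d i + d j"
  shows "diag d \<in> Der (nice_bracket L)"
proof -
  have "diag d *v nice_bracket L' x y
      = nice_bracket L' (diag d *v x) y + nice_bracket L' x (diag d *v y)"
    if "set L' \<subseteq> set L" for L' x y
    using that
  proof (induction L')
    case (Cons t L')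
    obtain i j k where t: "t = (i, j, k)" by (cases t)
    with Cons.prems assms have "d k = d i + d j" by auto
    then have "(\<chi> l. d l * ((x $ i * y $ j - x $ j * y $ i) *\<^sub>R axis k 1) $ l)
       = (d i * x $ i * y $ j - d j * x $ j * y $ i
          + (x $ i * (d j * y $ j) - x $ j * (d i * y $ i))) *\<^sub>R axis k 1"
      by (simp add: vec_eq_iff axis_def algebra_simps)
    with Cons show ?case
      by (simp add: t diag_mult_vec vec_eq_iff algebra_simps)
  qed (simp add: diag_mult_vec vec_eq_iff)
  then show ?thesis by (simp add: Der_def)
qed

text \<open>This is the e_k coefficient of A[e_i, e_j] = [A e_i, e_j] + [e_i, A e_j]. In this form,
  concrete indices and a concrete list simplify to a linear equation between entries of
  \<open>A\<close>.\<close>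

lemma Der_nice_entry:
  assumes "A \<in> Der (nice_bracket L)"
  shows "(\<Sum>(p, q, r)\<leftarrow>L. (of_bool (i = p \<and> j = q) - of_bool (i = q \<and> j = p)) * A $ k $ r)
    = (\<Sum>(p, q, r)\<leftarrow>L. of_bool (k = r) *
        (A $ p $ i * of_bool (j = q) - A $ q $ i * of_bool (j = p)
         + of_bool (i = p) * A $ q $ j - of_bool (i = q) * A $ p $ j))"
proof -
  have "(A *v nice_bracket L (axis i 1) (axis j 1)) $ k
    = (\<Sum>(p, q, r)\<leftarrow>L. (of_bool (i = p \<and> j = q) - of_bool (i = q \<and> j = p)) * A $ k $ r)"
    by (induction L) (auto simp: axis_def matrix_vector_right_distrib matrix_vector_mult_scaleR
        matrix_vector_mult_basis[unfolded axis_def] column_def algebra_simps)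
  moreover have "(nice_bracket L (column i A) (axis j 1) + nice_bracket L (axis i 1) (column j A)) $ k
    = (\<Sum>(p, q, r)\<leftarrow>L. of_bool (k = r) *
        (A $ p $ i * of_bool (j = q) - A $ q $ i * of_bool (j = p)
         + of_bool (i = p) * A $ q $ j - of_bool (i = q) * A $ p $ j))"
    by (induction L) (auto simp: axis_def column_def algebra_simps)
  ultimately show ?thesis
    using assms by (simp add: Der_def matrix_vector_mult_basis)
qed

section \<open>Semisimple derivations and the abelianization\<close>

lemma subspace_lower_central_series: "subspace (lower_central_series br m)"
  by (cases m) auto

text \<open>By induction the whole algebra is K plus the m-th term of the series: bracketing two
  such decompositions puts [n,n] into K plus the next term, and K covers n modulo [n,n]. Nilpotency
  then removes the second summand.\<close>

lemma subalgebra_eq_UNIV: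
  assumes lie: "lie_algebra br" and nil: "lower_central_series br m = {0}"
    and K: "subspace K" "\<And>x y. x \<in> K \<Longrightarrow> y \<in> K \<Longrightarrow> br x y \<in> K"
    and gen: "\<And>x. \<exists>u\<in>K. x - u \<in> lower_central_series br 1"
  shows "K = UNIV"
proof -
  let ?S = "\<lambda>m. {u + w | u w. u \<in> K \<and> w \<in> lower_central_series br m}"
  have bil: "bilinear br" and alt: "br x x = 0" for x
    using lie by (auto simp: lie_algebra_def)
  have anti: "br x y = - br y x" for x y
    using alt[of "x + y"] alt[of x] alt[of y] bil
    by (simp add: bilinear_ladd bilinear_radd eq_neg_iff_add_eq_0 add.commute)
  have "UNIV \<subseteq> ?S m"
  proof (induction m)
    case 0
    then show ?case using subspace_0[OF K(1)] by force
  next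
    case (Suc m)
    have sub: "subspace (?S (Suc m))"
      by (intro subspace_sums K(1) subspace_lower_central_series)
    have "br x y \<in> ?S (Suc m)" for x y
    proof -
      obtain u w u' w' where x: "x = u + w" and y: "y = u' + w'" and
        uw: "u \<in> K" "w \<in> lower_central_series br m" "u' \<in> K" "w' \<in> lower_central_series br m"
        using Suc by blast
      have "br u w' \<in> lower_central_series br (Suc m)" "br y w \<in> lower_central_series br (Suc m)"
        using uw by (auto intro!: span_base)
      then have "br u w' - br y w \<in> lower_central_series br (Suc m)"
        by (intro subspace_diff subspace_lower_central_series)
      \<comment> \<open>Only [u, u'] avoids the series, and it lies in the subalgebra K; [w, y] is
        written as -[y, w] to bring w into the second slot.\<close>
      moreover have "br x y = br u u' + (br u w' - br y w)"
        using anti[of w y] by (simp add: x y bilinear_ladd[OF bil] bilinear_radd[OF bil])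
      ultimately show ?thesis using K(2)[OF uw(1,3)] by blast
    qed
    then have "lower_central_series br 1 \<subseteq> ?S (Suc m)"
      unfolding One_nat_def lower_central_series.simps(2)[of br 0]
      by (intro span_minimal sub) blast
    moreover have "K \<subseteq> ?S (Suc m)"
      using subspace_0[OF subspace_lower_central_series[of br "Suc m"]] by force
    ultimately show ?case
      using gen subspace_add[OF sub] by (metis (no_types, lifting) UNIV_I add.commute diff_add_cancel subset_iff)
  qed
  then show ?thesis using nil by auto
qed

text \<open>Diagonalizability is essential: inner derivations also map into [n,n]. It splits the
  space into the kernel, which is a subalgebra, and eigenvectors lying in [n,n].\<close>

lemma semisimple_derivation_eq_0:
  assumes lie: "lie_algebra br" and nil: "lower_central_series br m = {0}"
    and A: "A \<in> Der br" "real_semisimple A"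
    and im: "\<And>x. A *v x \<in> lower_central_series br 1"
  shows "A = 0"
proof -
  let ?K = "{x. A *v x = 0}"
  have bil: "bilinear br" using lie by (simp add: lie_algebra_def)
  have K: "subspace ?K"
    by (auto simp: subspace_def matrix_vector_right_distrib matrix_vector_mult_scaleR)
  have Kc: "br x y \<in> ?K" if "x \<in> ?K" "y \<in> ?K" for x y
    using that A(1) bil by (simp add: Der_def bilinear_lzero bilinear_rzero)
  obtain ds bs where bs: "length bs = length ds" "span (set bs) = UNIV"
    "\<And>i. i < length ds \<Longrightarrow> A *v (bs ! i) = (ds ! i) *\<^sub>R (bs ! i)"
    using A(2) by (auto simp: real_semisimple_def diagonal_on_def)
  let ?S = "{u + w | u w. u \<in> ?K \<and> w \<in> lower_central_series br 1}"
  have "b \<in> ?S" if b: "b \<in> set bs" for b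
  proof -
    obtain i where "i < length bs" "bs ! i = b"
      using b by (auto simp: in_set_conv_nth)
    then obtain c where c: "A *v b = c *\<^sub>R b"
      using bs(1) bs(3)[of i] by auto
    show ?thesis
    proof (cases "c = 0")
      case True
      then have "b \<in> ?K" using c by simp
      moreover have "0 \<in> lower_central_series br 1"
        by (rule subspace_0[OF subspace_lower_central_series])
      moreover have "b = b + 0" by simp
      ultimately show ?thesis by blast
    next
      case False
      \<comment> \<open>An eigenvector with nonzero eigenvalue is the image of a multiple of
        itself.\<close>
      then have "b = 0 + (1 / c) *\<^sub>R (A *v b)" by (simp add: c)
      moreover have "(1 / c) *\<^sub>R (A *v b) \<in> lower_central_series br 1"
        by (rule subspace_scale[OF subspace_lower_central_series im])
      moreover have "0 \<in> ?K" by simp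
      ultimately show ?thesis by blast
    qed
  qed
  then have "set bs \<subseteq> ?S" by (rule subsetI)
  then have le: "span (set bs) \<subseteq> ?S"
    by (rule span_minimal) (rule subspace_sums[OF K subspace_lower_central_series])
  have "x \<in> span (set bs)" for x by (simp only: bs(2) UNIV_I)
  then have S: "x \<in> ?S" for x by (rule subsetD[OF le])
  have gen: "\<exists>u\<in>?K. x - u \<in> lower_central_series br 1" for x
  proof -
    from S[of x] obtain u w where "x = u + w" "u \<in> ?K" "w \<in> lower_central_series br 1" by blast
    then show ?thesis by (intro bexI[of _ u]) auto
  qed
  have "?K = UNIV"
    by (rule subalgebra_eq_UNIV[OF lie nil K Kc gen])
  then have "A *v x = 0 *v x" for x by auto
  then show ?thesis by (simp add: matrix_eq)
qed

lemma Der_lower_central_series_1: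
  assumes bil: "bilinear br" and A: "A \<in> Der br" and x: "x \<in> lower_central_series br 1"
  shows "A *v x \<in> lower_central_series br 1"
proof -
  have "lower_central_series br 1 \<subseteq> {x. A *v x \<in> lower_central_series br 1}"
    unfolding One_nat_def lower_central_series.simps
  proof (rule span_minimal)
    show "{br x y |x y. y \<in> UNIV} \<subseteq> {x. A *v x \<in> span {br x y |x y. y \<in> UNIV}}"
    proof clarify
      fix x y
      have "A *v br x y = br (A *v x) y + br x (A *v y)" using A by (simp add: Der_def)
      then show "A *v br x y \<in> span {br x y |x y. y \<in> UNIV}"
        by (simp only:) (intro span_add span_base; blast)
    qed
    show "subspace {x. A *v x \<in> span {br x y |x y. y \<in> UNIV}}"
      by (auto simp: subspace_def matrix_vector_right_distrib matrix_vector_mult_scaleR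
          span_zero span_add span_scale)
  qed
  with x show ?thesis by blast
qed

section \<open>Rank and pre-Einstein derivation\<close>

lemma subspace_Der:
  assumes "bilinear br"
  shows "subspace (Der br)"
  unfolding subspace_def Der_def
  by (auto simp: bilinear_lzero[OF assms] bilinear_rzero[OF assms]
      bilinear_ladd[OF assms] bilinear_radd[OF assms] bilinear_lmul[OF assms] bilinear_rmul[OF assms]
      matrix_vector_mult_add_rdistrib scaleR_matrix_vector_assoc[symmetric] algebra_simps)

lemma trace_scaleR: "trace (c *\<^sub>R A) = c * trace (A :: real ^ 'n ^ 'n::finite)"
  by (simp add: trace_def sum_distrib_left)

text \<open>By \<open>eq0\<close> the trace is injective on every torus, so nonzero tori are lines.
  This settles the dimension of all maximal tori directly, without conjugacy, and makes the
  \<open>THE\<close> in \<open>lie_rank\<close> well defined.\<close>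

lemma lie_rank_eq_1:
  assumes bil: "bilinear br"
    and D: "D \<in> Der br" "\<And>c. real_semisimple (c *\<^sub>R D)" "trace D \<noteq> 0"
    and eq0: "\<And>A. A \<in> Der br \<Longrightarrow> real_semisimple A \<Longrightarrow> trace A = 0 \<Longrightarrow> A = 0"
  shows "lie_rank br = 1"
proof -
  have line: "T = span {A}" if T: "torus br T" and A: "A \<in> T" "A \<noteq> 0" for T A
  proof
    have trA: "trace A \<noteq> 0" using eq0 T A by (auto simp: torus_def)
    show "T \<subseteq> span {A}"
    proof
      fix B assume B: "B \<in> T"
      \<comment> \<open>The multiple of A is chosen to cancel the trace; the difference stays in the
        torus and is therefore zero.\<close>
      let ?C = "B - (trace B / trace A) *\<^sub>R A"
      have "?C \<in> T"
        using T A B by (auto simp: torus_def intro!: subspace_diff subspace_scale)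
      moreover have "trace ?C = 0"
        using trA by (simp add: trace_sub trace_scaleR)
      ultimately have "?C = 0" using eq0 T unfolding torus_def by blast
      then show "B \<in> span {A}" by (simp add: span_singleton)
    qed
    show "span {A} \<subseteq> T"
      using T A by (intro span_minimal) (auto simp: torus_def)
  qed
  have "D \<noteq> 0" using D(3) by (auto simp: trace_def)
  have tD: "torus br (span {D})"
    unfolding torus_def span_singleton
  proof (intro conjI ballI)
    show "subspace (range (\<lambda>c. c *\<^sub>R D))"
      by (metis span_singleton subspace_span)
    show "range (\<lambda>c. c *\<^sub>R D) \<subseteq> Der br"
      using subspace_scale[OF subspace_Der[OF bil] D(1)] by blast
  qed (use D(2) in \<open>auto simp: matrix_scalar_ac scalar_matrix_assoc[symmetric]\<close>)
  have max: "maximal_torus br (span {D})"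
    unfolding maximal_torus_def using tD line \<open>D \<noteq> 0\<close> span_base[of D "{D}"] by blast
  have dim1: "dim T = 1" if T: "maximal_torus br T" for T
  proof -
    have "0 \<in> T" using T subspace_0 by (auto simp: maximal_torus_def torus_def)
    \<comment> \<open>The zero torus is not maximal, being properly contained in the line through
      D.\<close>
    moreover have "T \<noteq> {0}"
    proof
      assume "T = {0}"
      then have "T = span {D}" using T tD span_zero by (auto simp: maximal_torus_def)
      then show False using \<open>T = {0}\<close> \<open>D \<noteq> 0\<close> span_base[of D "{D}"] by auto
    qed
    ultimately obtain A where "A \<in> T" "A \<noteq> 0" by blast
    then show ?thesis
      using line[of T A] T by (simp add: maximal_torus_def dim_eq_card_independent)
  qed
  show ?thesis
    unfolding lie_rank_def using max dim1 by (intro the_equality) blast+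
qed

text \<open>The hypothesis \<open>Der\<close> is the only information about derivations to be
  checked on a concrete list: diagonal entries proportional to the weights, and no mixing of
  distinct generators. Entries from [n,n] to a generator vanish automatically, since derivations
  preserve [n,n].\<close>

lemma nice_rank_1:
  fixes L :: "('n::finite \<times> 'n \<times> 'n) list" and d :: "'n \<Rightarrow> real"
  assumes lie: "lie_algebra (nice_bracket L)" and nice: "nice L"
    and nil: "lcs_support L m = {}"
    and d: "\<forall>(i, j, k)\<in>set L. d k = d i + d j" "sum d UNIV \<noteq> 0"
    and Der: "\<And>A. A \<in> Der (nice_bracket L) \<Longrightarrow>
      \<exists>c. (\<forall>i. A $ i $ i = c * d i) \<and>
        (\<forall>i j. i \<notin> lcs_support L 1 \<longrightarrow> j \<notin> lcs_support L 1 \<longrightarrow> i \<noteq> j \<longrightarrow> A $ i $ j = 0)"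
  shows "lie_rank (nice_bracket L) = 1" "pre_einstein_nonzero (nice_bracket L)"
proof -
  let ?br = "nice_bracket L" and ?D = "diag d"
  note lcs = lower_central_series_nice[OF nice]
  have D: "?D \<in> Der ?br" by (rule diag_in_Der[OF d(1)])
  have trD: "trace ?D \<noteq> 0" using d(2) by (simp add: trace_diag)
  have scale: "c *\<^sub>R ?D = diag (\<lambda>i. c * d i)" for c
    by (simp add: diag_def vec_eq_iff)
  show "lie_rank ?br = 1"
  proof (rule lie_rank_eq_1[OF bilinear_nice_bracket D _ trD])
    show "real_semisimple (c *\<^sub>R ?D)" for c
      by (simp add: scale real_semisimple_diag)
    fix A assume A: "A \<in> Der ?br" "real_semisimple A" "trace A = 0"
    from Der[OF A(1)] obtain c where c: "\<And>i. A $ i $ i = c * d i"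
      and off: "\<And>i j. i \<notin> lcs_support L 1 \<Longrightarrow> j \<notin> lcs_support L 1 \<Longrightarrow> i \<noteq> j \<Longrightarrow> A $ i $ j = 0"
      by blast
    \<comment> \<open>The trace is c times the nonzero sum of the weights.\<close>
    have "c = 0"
      using A(3) d(2) by (simp add: trace_def c flip: sum_distrib_left)
    then have gen: "A $ i $ j = 0" if "i \<notin> lcs_support L 1" "j \<notin> lcs_support L 1" for i j
      using that off c by (cases "i = j") auto
    have "A $ i $ j = 0" if i: "i \<notin> lcs_support L 1" for i j
    proof (cases "j \<in> lcs_support L 1")
      case True
      then have "axis j 1 \<in> lower_central_series ?br 1"
        by (auto simp: lcs coord_subspace_def axis_def simp del: lower_central_series.simps lcs_support.simps)
      from Der_lower_central_series_1[OF bilinear_nice_bracket A(1) this] i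
      show ?thesis
        by (simp add: lcs coord_subspace_def matrix_vector_mult_basis column_def
          del: lower_central_series.simps lcs_support.simps)
    qed (use gen i in auto)
    then have "A *v x \<in> lower_central_series ?br 1" for x
      by (simp add: lcs coord_subspace_def matrix_vector_mult_def
          del: lower_central_series.simps lcs_support.simps)
    moreover have "lower_central_series ?br m = {0}"
      by (simp add: lcs nil coord_subspace_eq_0_iff)
    ultimately show "A = 0"
      using semisimple_derivation_eq_0[OF lie _ A(1,2)] by blast
  qed
  \<comment> \<open>As D is diagonal, tr(DA) sees only the diagonal of A, which is c times that of
    D. Thus tr(DA) = c tr(D^2) and tr A = c tr D, which dictates the factor making qD
    pre-Einstein.\<close>
  let ?q = "trace ?D / trace (?D ** ?D)"
  have "(\<Sum>i\<in>UNIV. d i * d i) \<noteq> 0"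
    using d(2) by (auto simp: sum_nonneg_eq_0_iff intro: sum.neutral)
  then have q: "trace (?D ** ?D) \<noteq> 0"
    by (simp add: trace_diag_mult) (simp add: diag_def)
  have "trace (?q *\<^sub>R ?D ** A) = trace A" if "A \<in> Der ?br" for A
  proof -
    from Der[OF that] obtain c where c: "\<And>i. A $ i $ i = c * d i" by blast
    have "trace (?D ** A) = c * trace (?D ** ?D)"
      by (simp add: trace_diag_mult c sum_distrib_left) (simp add: diag_def mult_ac)
    moreover have "trace A = c * trace ?D"
      by (simp add: trace_def c sum_distrib_left) (simp add: diag_def)
    ultimately show ?thesis
      using q by (simp add: scalar_matrix_assoc[symmetric] trace_scaleR)
  qed
  then have "pre_einstein ?br (?q *\<^sub>R ?D)"
    using subspace_scale[OF subspace_Der[OF bilinear_nice_bracket] D, of ?q]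
      real_semisimple_diag[of "\<lambda>i. ?q * d i"]
    by (simp only: pre_einstein_def scale) simp
  moreover have "\<phi> \<noteq> 0" if "pre_einstein ?br \<phi>" for \<phi>
  proof
    assume "\<phi> = 0"
    \<comment> \<open>Testing the zero derivation against D would give tr D = 0.\<close>
    then have "trace (\<phi> ** ?D) = 0" by (simp add: trace_def matrix_matrix_mult_def)
    with that D trD show False by (simp add: pre_einstein_def)
  qed
  ultimately show "pre_einstein_nonzero ?br"
    by (auto simp: pre_einstein_nonzero_def)
qed

section \<open>Dimension 13\<close>

text \<open>
  The basis is \<open>a\<^sub>1, \<dots>, a\<^sub>7, b\<^sub>1, \<dots>, b\<^sub>5, c\<close>, where \<open>a\<^sub>i\<close> has weight \<open>i\<close>, \<open>b\<^sub>i\<close> has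
  weight \<open>-i\<close> and \<open>c\<close> has weight 1; the generators are \<open>a\<^sub>1, a\<^sub>5, b\<^sub>1, b\<^sub>3\<close>. The brackets were found
  by a computer search through iterated one-dimensional graded central extensions.
\<close>

lemma UNIV_13: "(UNIV :: 13 set) =
    {1, 2, 3, 4, 5, 6, 7, 8, 9, 10, 11, 12, 13}"
  by (rule sym, rule card_subset_eq) simp_all

lemma forall_13: "(\<forall>i::13. P i) \<longleftrightarrow>
    P 1 \<and> P 2 \<and> P 3 \<and> P 4 \<and> P 5 \<and> P 6 \<and> P 7 \<and> P 8 \<and>
    P 9 \<and> P 10 \<and> P 11 \<and> P 12 \<and> P 13"
proof -
  have "(\<forall>i::13. P i) \<longleftrightarrow> (\<forall>i\<in>UNIV. P i)" by simp
  then show ?thesis by (simp only: UNIV_13 ball_simps simp_thms)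
qed

text \<open>Nine triples determine the weights of the non-generators. The other five, from repeated
  targets 7, 12 and 13, relate the four generator weights and leave a single free parameter.\<close>

definition brackets13 :: "(13 \<times> 13 \<times> 13) list" where
  "brackets13 = [
    (5, 1, 6), (1, 6, 7), (10, 1, 9), (2, 5, 7), (2, 8, 13), (4, 3, 7), (8, 3, 2),
    (4, 8, 3), (4, 10, 13), (8, 5, 4), (11, 5, 13), (8, 10, 11), (8, 11, 12), (9, 10, 12)]"

text \<open>Positions are filled from 1 upwards; in the index type the numeral 13 denotes 0, so the
  last entry sits at that index.\<close>

definition weight13 :: "13 \<Rightarrow> real" where
  "weight13 i = vector [1, 2, 3, 4, 5, 6, 7, -1, -2, -3, -4, -5, 1] $ i"

lemma weight13_simps:
  "weight13 1 = 1" "weight13 2 = 2" "weight13 3 = 3" "weight13 4 = 4" "weight13 5 = 5" "weight13 6 = 6" "weight13 7 = 7"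
  "weight13 8 = -1" "weight13 9 = -2" "weight13 10 = -3" "weight13 11 = -4" "weight13 12 = -5" "weight13 13 = 1"
  by (simp_all add: weight13_def vector_def)

lemma nice_brackets13: "nice brackets13"
  by (simp add: nice_def brackets13_def axis_def vec_eq_iff)

lemma lcs_support_brackets13:
  shows "lcs_support brackets13 (Suc 0) = {2, 3, 4, 6, 7, 9, 11, 12, 13}"
    and "lcs_support brackets13 (Suc (Suc 0)) = {2, 3, 7, 12, 13}"
    and "lcs_support brackets13 (Suc (Suc (Suc 0))) = {2, 7, 13}"
    and "lcs_support brackets13 (Suc (Suc (Suc (Suc 0)))) = {7, 13}"
    and "lcs_support brackets13 (Suc (Suc (Suc (Suc (Suc 0))))) = {}"
proof -
  show s1: "lcs_support brackets13 (Suc 0) = {2, 3, 4, 6, 7, 9, 11, 12, 13}"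
    unfolding lcs_support.simps(2)[of brackets13 "0"] lcs_support.simps(1) by (auto simp: brackets13_def)
  \<comment> \<open>Each stage is unfolded once and rewritten with the previous one, which avoids
    nested filters.\<close>
  show s2: "lcs_support brackets13 (Suc (Suc 0)) = {2, 3, 7, 12, 13}"
    unfolding lcs_support.simps(2)[of brackets13 "Suc 0"] s1 by (auto simp: brackets13_def)
  show s3: "lcs_support brackets13 (Suc (Suc (Suc 0))) = {2, 7, 13}"
    unfolding lcs_support.simps(2)[of brackets13 "Suc (Suc 0)"] s2 by (auto simp: brackets13_def)
  show s4: "lcs_support brackets13 (Suc (Suc (Suc (Suc 0)))) = {7, 13}"
    unfolding lcs_support.simps(2)[of brackets13 "Suc (Suc (Suc 0))"] s3 by (auto simp: brackets13_def)
  show s5: "lcs_support brackets13 (Suc (Suc (Suc (Suc (Suc 0))))) = {}"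
    unfolding lcs_support.simps(2)[of brackets13 "Suc (Suc (Suc (Suc 0)))"] s4 by (auto simp: brackets13_def)
qed

lemma step_nilpotent_brackets13: "step_nilpotent 5 (nice_bracket brackets13)"
  using step_nilpotent_nice[OF nice_brackets13, of "Suc (Suc (Suc (Suc 0)))"]
  by (simp add: lcs_support_brackets13 numeral_eq_Suc del: lcs_support.simps)

text \<open>With components as explicit polynomials, the Jacobi identity becomes one polynomial
  identity per coordinate, and the center a linear system.\<close>

lemma brackets13_nth:
  "nice_bracket brackets13 x y $ 1 = 0"
  "nice_bracket brackets13 x y $ 2 = x $ 8 * y $ 3 - x $ 3 * y $ 8"
  "nice_bracket brackets13 x y $ 3 = x $ 4 * y $ 8 - x $ 8 * y $ 4"
  "nice_bracket brackets13 x y $ 4 = x $ 8 * y $ 5 - x $ 5 * y $ 8"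
  "nice_bracket brackets13 x y $ 5 = 0"
  "nice_bracket brackets13 x y $ 6 = x $ 5 * y $ 1 - x $ 1 * y $ 5"
  "nice_bracket brackets13 x y $ 7 =
      (x $ 1 * y $ 6 - x $ 6 * y $ 1) + (x $ 2 * y $ 5 - x $ 5 * y $ 2) +
      (x $ 4 * y $ 3 - x $ 3 * y $ 4)"
  "nice_bracket brackets13 x y $ 8 = 0"
  "nice_bracket brackets13 x y $ 9 = x $ 10 * y $ 1 - x $ 1 * y $ 10"
  "nice_bracket brackets13 x y $ 10 = 0"
  "nice_bracket brackets13 x y $ 11 = x $ 8 * y $ 10 - x $ 10 * y $ 8"
  "nice_bracket brackets13 x y $ 12 =
      (x $ 8 * y $ 11 - x $ 11 * y $ 8) + (x $ 9 * y $ 10 - x $ 10 * y $ 9)"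
  "nice_bracket brackets13 x y $ 13 =
      (x $ 2 * y $ 8 - x $ 8 * y $ 2) + (x $ 4 * y $ 10 - x $ 10 * y $ 4) +
      (x $ 11 * y $ 5 - x $ 5 * y $ 11)"
  by (simp_all add: brackets13_def axis_def)

lemma lie_algebra_brackets13: "lie_algebra (nice_bracket brackets13)"
  by (rule lie_algebra_nice_bracketI,
      simp only: vec_eq_iff forall_13 brackets13_nth vector_add_component zero_index,
      intro conjI; simp add: algebra_simps)

lemma lie_center_brackets13: "lie_center (nice_bracket brackets13) = coord_subspace {7, 12, 13}"
proof
  show "lie_center (nice_bracket brackets13) \<subseteq> coord_subspace {7, 12, 13}"
  proof
    fix x assume "x \<in> lie_center (nice_bracket brackets13)"
    then have E: "nice_bracket brackets13 x (axis j 1) $ k = 0" for j k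
      by (simp add: lie_center_def)
    show "x \<in> coord_subspace {7, 12, 13}"
      \<comment> \<open>Each instance brackets \<open>x\<close> with one basis vector and reads off
        one component, isolating one of the ten coordinates that must vanish.\<close>
      using
        E[of 5 6] E[of 5 7] E[of 4 7] E[of 3 7] E[of 1 6] E[of 1 7] E[of 2 13] E[of 10 12]
        E[of 1 9] E[of 5 13]
      by (simp add: coord_subspace_def forall_13 brackets13_nth axis_def)
  qed
  show "coord_subspace {7, 12, 13} \<subseteq> lie_center (nice_bracket brackets13)"
    by (auto simp: lie_center_def coord_subspace_def vec_eq_iff forall_13 brackets13_nth)
qed

lemma Der_brackets13:
  assumes "A \<in> Der (nice_bracket brackets13)"
  shows "\<exists>c. (\<forall>i. A $ i $ i = c * weight13 i) \<and>
    (\<forall>i j. i \<notin> lcs_support brackets13 1 \<longrightarrow> j \<notin> lcs_support brackets13 1 \<longrightarrow> i \<noteq> j \<longrightarrow> A $ i $ j = 0)"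
proof -
  note E = Der_nice_entry[OF assms]
  have off:
    "A $ 5 $ 1 = 0" "A $ 8 $ 1 = 0" "A $ 10 $ 1 = 0" "A $ 1 $ 5 = 0" "A $ 8 $ 5 = 0"
    "A $ 10 $ 5 = 0" "A $ 1 $ 8 = 0" "A $ 5 $ 8 = 0" "A $ 10 $ 8 = 0" "A $ 1 $ 10 = 0"
    "A $ 5 $ 10 = 0" "A $ 8 $ 10 = 0"
  proof -
    \<comment> \<open>In each of these lines the chosen pair has zero bracket, and the target leaves
      a single entry of \<open>A\<close>. Here the component along a_4 sees only [b_1, a_5] =
      a_4.\<close>
    show "A $ 5 $ 1 = 0"
      using E[of 1 8 4] by (simp add: brackets13_def)
    show "A $ 8 $ 1 = 0"
      using E[of 1 2 13] by (simp add: brackets13_def)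
    show "A $ 10 $ 1 = 0"
      using E[of 1 4 13] by (simp add: brackets13_def)
    show "A $ 1 $ 5 = 0"
      using E[of 5 10 9] by (simp add: brackets13_def)
    show "A $ 8 $ 5 = 0"
      using E[of 3 5 2] by (simp add: brackets13_def)
    show "A $ 10 $ 5 = 0"
      using E[of 5 9 12] by (simp add: brackets13_def)
    show "A $ 1 $ 8 = 0"
      using E[of 6 8 7] by (simp add: brackets13_def)
    show "A $ 5 $ 8 = 0"
      using E[of 1 8 6] by (simp add: brackets13_def)
    show "A $ 10 $ 8 = 0"
      using E[of 1 8 9] by (simp add: brackets13_def)
    show "A $ 1 $ 10 = 0"
      using E[of 5 10 6] by (simp add: brackets13_def)
    show "A $ 5 $ 10 = 0"
      using E[of 2 10 7] by (simp add: brackets13_def)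
    show "A $ 8 $ 10 = 0"
      using E[of 5 10 4] by (simp add: brackets13_def)
  qed
  \<comment> \<open>One equation per triple, read at its own target. Triples with a common target
    have disjoint sources here, so no off-diagonal entries intervene.\<close>
  have brackets:
    "A $ 6 $ 6 = A $ 5 $ 5 + A $ 1 $ 1" "A $ 7 $ 7 = A $ 1 $ 1 + A $ 6 $ 6"
    "A $ 9 $ 9 = A $ 10 $ 10 + A $ 1 $ 1" "A $ 7 $ 7 = A $ 2 $ 2 + A $ 5 $ 5"
    "A $ 13 $ 13 = A $ 2 $ 2 + A $ 8 $ 8" "A $ 7 $ 7 = A $ 4 $ 4 + A $ 3 $ 3"
    "A $ 2 $ 2 = A $ 8 $ 8 + A $ 3 $ 3" "A $ 3 $ 3 = A $ 4 $ 4 + A $ 8 $ 8"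
    "A $ 13 $ 13 = A $ 4 $ 4 + A $ 10 $ 10" "A $ 4 $ 4 = A $ 8 $ 8 + A $ 5 $ 5"
    "A $ 13 $ 13 = A $ 11 $ 11 + A $ 5 $ 5" "A $ 11 $ 11 = A $ 8 $ 8 + A $ 10 $ 10"
    "A $ 12 $ 12 = A $ 8 $ 8 + A $ 11 $ 11" "A $ 12 $ 12 = A $ 9 $ 9 + A $ 10 $ 10"
  proof -
    show "A $ 6 $ 6 = A $ 5 $ 5 + A $ 1 $ 1"
      using E[of 5 1 6] by (simp add: brackets13_def)
    show "A $ 7 $ 7 = A $ 1 $ 1 + A $ 6 $ 6"
      using E[of 1 6 7] by (simp add: brackets13_def)
    show "A $ 9 $ 9 = A $ 10 $ 10 + A $ 1 $ 1"
      using E[of 10 1 9] by (simp add: brackets13_def)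
    show "A $ 7 $ 7 = A $ 2 $ 2 + A $ 5 $ 5"
      using E[of 2 5 7] by (simp add: brackets13_def)
    show "A $ 13 $ 13 = A $ 2 $ 2 + A $ 8 $ 8"
      using E[of 2 8 13] by (simp add: brackets13_def)
    show "A $ 7 $ 7 = A $ 4 $ 4 + A $ 3 $ 3"
      using E[of 4 3 7] by (simp add: brackets13_def)
    show "A $ 2 $ 2 = A $ 8 $ 8 + A $ 3 $ 3"
      using E[of 8 3 2] by (simp add: brackets13_def)
    show "A $ 3 $ 3 = A $ 4 $ 4 + A $ 8 $ 8"
      using E[of 4 8 3] by (simp add: brackets13_def)
    show "A $ 13 $ 13 = A $ 4 $ 4 + A $ 10 $ 10"
      using E[of 4 10 13] by (simp add: brackets13_def)
    show "A $ 4 $ 4 = A $ 8 $ 8 + A $ 5 $ 5"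
      using E[of 8 5 4] by (simp add: brackets13_def)
    show "A $ 13 $ 13 = A $ 11 $ 11 + A $ 5 $ 5"
      using E[of 11 5 13] by (simp add: brackets13_def)
    show "A $ 11 $ 11 = A $ 8 $ 8 + A $ 10 $ 10"
      using E[of 8 10 11] by (simp add: brackets13_def)
    show "A $ 12 $ 12 = A $ 8 $ 8 + A $ 11 $ 11"
      using E[of 8 11 12] by (simp add: brackets13_def)
    show "A $ 12 $ 12 = A $ 9 $ 9 + A $ 10 $ 10"
      using E[of 9 10 12] by (simp add: brackets13_def)
  qed
  \<comment> \<open>The generator weights are solved first, in units of the entry at a_1, which has
    weight 1; the others follow bracket by bracket.\<close>
  have d5: "A $ 5 $ 5 = A $ 1 $ 1 * 5"
    using brackets(1,2,3,4,5,6,7,8,9,11,13,14) by linarith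
  have d8: "A $ 8 $ 8 = A $ 1 $ 1 * -1"
    using brackets(3,5,7,8,9,12,13,14) by linarith
  have d10: "A $ 10 $ 10 = A $ 1 $ 1 * -3"
    using brackets(3,5,7,8,9,12,13,14) by linarith
  have d6: "A $ 6 $ 6 = A $ 1 $ 1 * 6"
    using brackets(1) d5 by simp
  have d7: "A $ 7 $ 7 = A $ 1 $ 1 * 7"
    using brackets(2) d6 by simp
  have d9: "A $ 9 $ 9 = A $ 1 $ 1 * -2"
    using brackets(3) d10 by simp
  have d4: "A $ 4 $ 4 = A $ 1 $ 1 * 4"
    using brackets(10) d8 d5 by simp
  have d11: "A $ 11 $ 11 = A $ 1 $ 1 * -4"
    using brackets(12) d8 d10 by simp
  have d12: "A $ 12 $ 12 = A $ 1 $ 1 * -5"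
    using brackets(13) d8 d11 by simp
  have d3: "A $ 3 $ 3 = A $ 1 $ 1 * 3"
    using brackets(8) d4 d8 by simp
  have d13: "A $ 13 $ 13 = A $ 1 $ 1 * 1"
    using brackets(9) d4 d10 by simp
  have d2: "A $ 2 $ 2 = A $ 1 $ 1 * 2"
    using brackets(7) d8 d3 by simp
  have "A $ i $ i = A $ 1 $ 1 * weight13 i" for i
  proof -
    have "\<forall>i. A $ i $ i = A $ 1 $ 1 * weight13 i"
      unfolding forall_13 weight13_simps
      using d2 d3 d4 d5 d6 d7 d8 d9 d10 d11 d12 d13 by simp
    then show ?thesis by blast
  qed
  moreover have "A $ i $ j = 0"
    if "i \<notin> lcs_support brackets13 1" "j \<notin> lcs_support brackets13 1" "i \<noteq> j" for i j
  proof -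
    have gens: "\<forall>i. i \<notin> lcs_support brackets13 1 \<longrightarrow> i \<in> {1, 5, 8, 10}"
      unfolding forall_13 One_nat_def lcs_support_brackets13 by simp
    from gens that have "i \<in> {1, 5, 8, 10}" "j \<in> {1, 5, 8, 10}" by blast+
    with off \<open>i \<noteq> j\<close> show ?thesis by auto
  qed
  ultimately show ?thesis by blast
qed

lemma weights_brackets13: "\<forall>(i, j, k)\<in>set brackets13. weight13 k = weight13 i + weight13 j"
  by (simp add: brackets13_def weight13_simps)

lemma sum_weight13: "sum weight13 UNIV = 14"
  unfolding UNIV_13 by (simp add: weight13_simps)

lemma rank_brackets13:
  "lie_rank (nice_bracket brackets13) = 1" "pre_einstein_nonzero (nice_bracket brackets13)"
  using nice_rank_1[OF lie_algebra_brackets13 nice_brackets13 lcs_support_brackets13(5) weights_brackets13 _ Der_brackets13]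
  by (simp_all add: sum_weight13)

lemma diagonal_on_brackets13:
  "diagonal_on UNIV (diag weight13) [1, 2, 3, 4, 5, 6, 7, -1, -2, -3, -4, -5, 1]"
  "diagonal_on (lie_center (nice_bracket brackets13)) (diag weight13) [7, -5, 1]"
proof -
  have "coord_subspace (set [1, 2, 3, 4, 5, 6, 7, 8, 9, 10, 11, 12, 13 :: 13]) = UNIV"
    by (simp add: coord_subspace_def forall_13)
  then show "diagonal_on UNIV (diag weight13) [1, 2, 3, 4, 5, 6, 7, -1, -2, -3, -4, -5, 1]"
    using diagonal_on_coord_subspace[of "[1, 2, 3, 4, 5, 6, 7, 8, 9, 10, 11, 12, 13]" weight13] by (simp add: weight13_simps)
  show "diagonal_on (lie_center (nice_bracket brackets13)) (diag weight13) [7, -5, 1]"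
    using diagonal_on_coord_subspace[of "[7, 12, 13]" weight13] by (simp add: lie_center_brackets13 weight13_simps)
qed

section \<open>Dimension 17\<close>

text \<open>
  The basis is \<open>b\<^sub>1, \<dots>, b\<^sub>7, a\<^sub>1, \<dots>, a\<^sub>7, c, d, e\<close>, where \<open>a\<^sub>i\<close> has weight \<open>i\<close>, \<open>b\<^sub>i\<close>
  has weight \<open>-i\<close>, and \<open>c, d, e\<close> have weights \<open>-1, 2, 1\<close>; the generators are
  \<open>b\<^sub>1, b\<^sub>3, b\<^sub>5, a\<^sub>1, a\<^sub>5\<close>.
\<close>

lemma UNIV_17: "(UNIV :: 17 set) =
    {1, 2, 3, 4, 5, 6, 7, 8, 9, 10, 11, 12, 13, 14, 15, 16, 17}"
  by (rule sym, rule card_subset_eq) simp_all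

lemma forall_17: "(\<forall>i::17. P i) \<longleftrightarrow>
    P 1 \<and> P 2 \<and> P 3 \<and> P 4 \<and> P 5 \<and> P 6 \<and> P 7 \<and> P 8 \<and>
    P 9 \<and> P 10 \<and> P 11 \<and> P 12 \<and> P 13 \<and> P 14 \<and> P 15 \<and>
    P 16 \<and> P 17"
proof -
  have "(\<forall>i::17. P i) \<longleftrightarrow> (\<forall>i\<in>UNIV. P i)" by simp
  then show ?thesis by (simp only: UNIV_17 ball_simps simp_thms)
qed

text \<open>Twelve of the nineteen triples determine the weights of the non-generators; the other
  seven leave one free parameter in the five generator weights.\<close>

definition brackets17 :: "(17 \<times> 17 \<times> 17) list" where
  "brackets17 = [
    (5, 1, 6), (1, 6, 7), (1, 9, 17), (1, 10, 16), (11, 1, 10), (12, 1, 11), (1, 16, 17),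
    (5, 2, 7), (8, 2, 15), (3, 4, 7), (8, 3, 2), (3, 9, 15), (11, 3, 17), (3, 12, 9),
    (8, 5, 4), (5, 11, 15), (12, 6, 15), (12, 8, 13), (13, 8, 14)]"

definition weight17 :: "17 \<Rightarrow> real" where
  "weight17 i = vector [-1, -2, -3, -4, -5, -6, -7, 1, 2, 3, 4, 5, 6, 7, -1, 2, 1] $ i"

lemma weight17_simps:
  "weight17 1 = -1" "weight17 2 = -2" "weight17 3 = -3" "weight17 4 = -4" "weight17 5 = -5" "weight17 6 = -6"
  "weight17 7 = -7" "weight17 8 = 1" "weight17 9 = 2" "weight17 10 = 3" "weight17 11 = 4" "weight17 12 = 5" "weight17 13 = 6"
  "weight17 14 = 7" "weight17 15 = -1" "weight17 16 = 2" "weight17 17 = 1"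
  by (simp_all add: weight17_def vector_def)

lemma nice_brackets17: "nice brackets17"
  by (simp add: nice_def brackets17_def axis_def vec_eq_iff)

lemma lcs_support_brackets17:
  shows "lcs_support brackets17 (Suc 0) = {2, 4, 6, 7, 9, 10, 11, 13, 14, 15, 16, 17}"
    and "lcs_support brackets17 (Suc (Suc 0)) = {7, 10, 14, 15, 16, 17}"
    and "lcs_support brackets17 (Suc (Suc (Suc 0))) = {16, 17}"
    and "lcs_support brackets17 (Suc (Suc (Suc (Suc 0)))) = {17}"
    and "lcs_support brackets17 (Suc (Suc (Suc (Suc (Suc 0))))) = {}"
proof -
  show s1: "lcs_support brackets17 (Suc 0) = {2, 4, 6, 7, 9, 10, 11, 13, 14, 15, 16, 17}"
    unfolding lcs_support.simps(2)[of brackets17 "0"] lcs_support.simps(1) by (auto simp: brackets17_def)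
  show s2: "lcs_support brackets17 (Suc (Suc 0)) = {7, 10, 14, 15, 16, 17}"
    unfolding lcs_support.simps(2)[of brackets17 "Suc 0"] s1 by (auto simp: brackets17_def)
  show s3: "lcs_support brackets17 (Suc (Suc (Suc 0))) = {16, 17}"
    unfolding lcs_support.simps(2)[of brackets17 "Suc (Suc 0)"] s2 by (auto simp: brackets17_def)
  show s4: "lcs_support brackets17 (Suc (Suc (Suc (Suc 0)))) = {17}"
    unfolding lcs_support.simps(2)[of brackets17 "Suc (Suc (Suc 0))"] s3 by (auto simp: brackets17_def)
  show s5: "lcs_support brackets17 (Suc (Suc (Suc (Suc (Suc 0))))) = {}"
    unfolding lcs_support.simps(2)[of brackets17 "Suc (Suc (Suc (Suc 0)))"] s4 by (auto simp: brackets17_def)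
qed

lemma step_nilpotent_brackets17: "step_nilpotent 5 (nice_bracket brackets17)"
  using step_nilpotent_nice[OF nice_brackets17, of "Suc (Suc (Suc (Suc 0)))"]
  by (simp add: lcs_support_brackets17 numeral_eq_Suc del: lcs_support.simps)

lemma brackets17_nth:
  "nice_bracket brackets17 x y $ 1 = 0"
  "nice_bracket brackets17 x y $ 2 = x $ 8 * y $ 3 - x $ 3 * y $ 8"
  "nice_bracket brackets17 x y $ 3 = 0"
  "nice_bracket brackets17 x y $ 4 = x $ 8 * y $ 5 - x $ 5 * y $ 8"
  "nice_bracket brackets17 x y $ 5 = 0"
  "nice_bracket brackets17 x y $ 6 = x $ 5 * y $ 1 - x $ 1 * y $ 5"
  "nice_bracket brackets17 x y $ 7 =
      (x $ 1 * y $ 6 - x $ 6 * y $ 1) + (x $ 5 * y $ 2 - x $ 2 * y $ 5) +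
      (x $ 3 * y $ 4 - x $ 4 * y $ 3)"
  "nice_bracket brackets17 x y $ 8 = 0"
  "nice_bracket brackets17 x y $ 9 = x $ 3 * y $ 12 - x $ 12 * y $ 3"
  "nice_bracket brackets17 x y $ 10 = x $ 11 * y $ 1 - x $ 1 * y $ 11"
  "nice_bracket brackets17 x y $ 11 = x $ 12 * y $ 1 - x $ 1 * y $ 12"
  "nice_bracket brackets17 x y $ 12 = 0"
  "nice_bracket brackets17 x y $ 13 = x $ 12 * y $ 8 - x $ 8 * y $ 12"
  "nice_bracket brackets17 x y $ 14 = x $ 13 * y $ 8 - x $ 8 * y $ 13"
  "nice_bracket brackets17 x y $ 15 =
      (x $ 8 * y $ 2 - x $ 2 * y $ 8) + (x $ 3 * y $ 9 - x $ 9 * y $ 3) +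
      (x $ 5 * y $ 11 - x $ 11 * y $ 5) + (x $ 12 * y $ 6 - x $ 6 * y $ 12)"
  "nice_bracket brackets17 x y $ 16 = x $ 1 * y $ 10 - x $ 10 * y $ 1"
  "nice_bracket brackets17 x y $ 17 =
      (x $ 1 * y $ 9 - x $ 9 * y $ 1) + (x $ 1 * y $ 16 - x $ 16 * y $ 1) +
      (x $ 11 * y $ 3 - x $ 3 * y $ 11)"
  by (simp_all add: brackets17_def axis_def)

lemma lie_algebra_brackets17: "lie_algebra (nice_bracket brackets17)"
  by (rule lie_algebra_nice_bracketI,
      simp only: vec_eq_iff forall_17 brackets17_nth vector_add_component zero_index,
      intro conjI; simp add: algebra_simps)

lemma lie_center_brackets17: "lie_center (nice_bracket brackets17) = coord_subspace {7, 14, 15, 17}"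
proof
  show "lie_center (nice_bracket brackets17) \<subseteq> coord_subspace {7, 14, 15, 17}"
  proof
    fix x assume "x \<in> lie_center (nice_bracket brackets17)"
    then have E: "nice_bracket brackets17 x (axis j 1) $ k = 0" for j k
      by (simp add: lie_center_def)
    show "x \<in> coord_subspace {7, 14, 15, 17}"
      \<comment> \<open>As in dimension 13, except that the instance for component 17 yields only
        the sum of coordinates 9 and 16; the instance \<open>E[of 3 15]\<close> removes the
        former.\<close>
      using
        E[of 5 6] E[of 5 7] E[of 4 7] E[of 3 7] E[of 1 6] E[of 1 7] E[of 2 15] E[of 3 15]
        E[of 1 16] E[of 1 10] E[of 1 11] E[of 8 14] E[of 1 17]
      by (simp add: coord_subspace_def forall_17 brackets17_nth axis_def)
  qed
  show "coord_subspace {7, 14, 15, 17} \<subseteq> lie_center (nice_bracket brackets17)"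
    by (auto simp: lie_center_def coord_subspace_def vec_eq_iff forall_17 brackets17_nth)
qed

lemma Der_brackets17:
  assumes "A \<in> Der (nice_bracket brackets17)"
  shows "\<exists>c. (\<forall>i. A $ i $ i = c * weight17 i) \<and>
    (\<forall>i j. i \<notin> lcs_support brackets17 1 \<longrightarrow> j \<notin> lcs_support brackets17 1 \<longrightarrow> i \<noteq> j \<longrightarrow> A $ i $ j = 0)"
proof -
  note E = Der_nice_entry[OF assms]
  have off:
    "A $ 3 $ 1 = 0" "A $ 5 $ 1 = 0" "A $ 8 $ 1 = 0" "A $ 12 $ 1 = 0" "A $ 1 $ 3 = 0"
    "A $ 5 $ 3 = 0" "A $ 8 $ 3 = 0" "A $ 12 $ 3 = 0" "A $ 1 $ 5 = 0" "A $ 3 $ 5 = 0"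
    "A $ 8 $ 5 = 0" "A $ 12 $ 5 = 0" "A $ 1 $ 8 = 0" "A $ 3 $ 8 = 0" "A $ 5 $ 8 = 0"
    "A $ 12 $ 8 = 0" "A $ 1 $ 12 = 0" "A $ 3 $ 12 = 0" "A $ 5 $ 12 = 0" "A $ 8 $ 12 = 0"
  proof -
    show "A $ 3 $ 1 = 0"
      using E[of 1 8 2] by (simp add: brackets17_def)
    show "A $ 5 $ 1 = 0"
      using E[of 1 8 4] by (simp add: brackets17_def)
    show "A $ 8 $ 1 = 0"
      using E[of 1 2 15] by (simp add: brackets17_def)
    show "A $ 12 $ 1 = 0"
      using E[of 1 3 9] by (simp add: brackets17_def)
    show "A $ 1 $ 3 = 0"
      using E[of 3 5 6] by (simp add: brackets17_def)
    show "A $ 5 $ 3 = 0"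
      using E[of 1 3 6] by (simp add: brackets17_def)
    show "A $ 8 $ 3 = 0"
      using E[of 3 5 4] by (simp add: brackets17_def)
    show "A $ 12 $ 3 = 0"
      using E[of 1 3 11] by (simp add: brackets17_def)
    show "A $ 1 $ 5 = 0"
      using E[of 5 12 11] by (simp add: brackets17_def)
    show "A $ 3 $ 5 = 0"
      using E[of 5 12 9] by (simp add: brackets17_def)
    show "A $ 8 $ 5 = 0"
      using E[of 3 5 2] by (simp add: brackets17_def)
    show "A $ 12 $ 5 = 0"
      using E[of 3 5 9] by (simp add: brackets17_def)
    show "A $ 1 $ 8 = 0"
      using E[of 8 10 16] by (simp add: brackets17_def)
    show "A $ 3 $ 8 = 0"
      using E[of 4 8 7] by (simp add: brackets17_def)
    show "A $ 5 $ 8 = 0"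
      using E[of 1 8 6] by (simp add: brackets17_def)
    show "A $ 12 $ 8 = 0"
      using E[of 1 8 11] by (simp add: brackets17_def)
    show "A $ 1 $ 12 = 0"
      using E[of 5 12 6] by (simp add: brackets17_def)
    show "A $ 3 $ 12 = 0"
      using E[of 4 12 7] by (simp add: brackets17_def)
    show "A $ 5 $ 12 = 0"
      using E[of 2 12 7] by (simp add: brackets17_def)
    show "A $ 8 $ 12 = 0"
      using E[of 5 12 4] by (simp add: brackets17_def)
  qed
  \<comment> \<open>Both [e_1, e_9] and [e_1, e_16] equal e_17, and e_9, e_16 have the same weight
    2, so the equations at e_17 involve these off-diagonal entries. They vanish by [e_3, e_12] = e_9
    read at e_16 and [e_3, e_16] = 0 read at e_15.\<close>
  have extra: "A $ 16 $ 9 = 0" "A $ 9 $ 16 = 0"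
    using E[of 3 12 16] E[of 3 16 15] by (simp_all add: brackets17_def)
  have brackets:
    "A $ 6 $ 6 = A $ 5 $ 5 + A $ 1 $ 1" "A $ 7 $ 7 = A $ 1 $ 1 + A $ 6 $ 6"
    "A $ 17 $ 17 = A $ 1 $ 1 + A $ 9 $ 9" "A $ 16 $ 16 = A $ 1 $ 1 + A $ 10 $ 10"
    "A $ 10 $ 10 = A $ 11 $ 11 + A $ 1 $ 1" "A $ 11 $ 11 = A $ 12 $ 12 + A $ 1 $ 1"
    "A $ 17 $ 17 = A $ 1 $ 1 + A $ 16 $ 16" "A $ 7 $ 7 = A $ 5 $ 5 + A $ 2 $ 2"
    "A $ 15 $ 15 = A $ 8 $ 8 + A $ 2 $ 2" "A $ 7 $ 7 = A $ 3 $ 3 + A $ 4 $ 4"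
    "A $ 2 $ 2 = A $ 8 $ 8 + A $ 3 $ 3" "A $ 15 $ 15 = A $ 3 $ 3 + A $ 9 $ 9"
    "A $ 17 $ 17 = A $ 11 $ 11 + A $ 3 $ 3" "A $ 9 $ 9 = A $ 3 $ 3 + A $ 12 $ 12"
    "A $ 4 $ 4 = A $ 8 $ 8 + A $ 5 $ 5" "A $ 15 $ 15 = A $ 5 $ 5 + A $ 11 $ 11"
    "A $ 15 $ 15 = A $ 12 $ 12 + A $ 6 $ 6" "A $ 13 $ 13 = A $ 12 $ 12 + A $ 8 $ 8"
    "A $ 14 $ 14 = A $ 13 $ 13 + A $ 8 $ 8"
  proof -
    show "A $ 6 $ 6 = A $ 5 $ 5 + A $ 1 $ 1"
      using E[of 5 1 6] by (simp add: brackets17_def extra)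
    show "A $ 7 $ 7 = A $ 1 $ 1 + A $ 6 $ 6"
      using E[of 1 6 7] by (simp add: brackets17_def extra)
    show "A $ 17 $ 17 = A $ 1 $ 1 + A $ 9 $ 9"
      using E[of 1 9 17] by (simp add: brackets17_def extra)
    show "A $ 16 $ 16 = A $ 1 $ 1 + A $ 10 $ 10"
      using E[of 1 10 16] by (simp add: brackets17_def extra)
    show "A $ 10 $ 10 = A $ 11 $ 11 + A $ 1 $ 1"
      using E[of 11 1 10] by (simp add: brackets17_def extra)
    show "A $ 11 $ 11 = A $ 12 $ 12 + A $ 1 $ 1"
      using E[of 12 1 11] by (simp add: brackets17_def extra)
    show "A $ 17 $ 17 = A $ 1 $ 1 + A $ 16 $ 16"
      using E[of 1 16 17] by (simp add: brackets17_def extra)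
    show "A $ 7 $ 7 = A $ 5 $ 5 + A $ 2 $ 2"
      using E[of 5 2 7] by (simp add: brackets17_def extra)
    show "A $ 15 $ 15 = A $ 8 $ 8 + A $ 2 $ 2"
      using E[of 8 2 15] by (simp add: brackets17_def extra)
    show "A $ 7 $ 7 = A $ 3 $ 3 + A $ 4 $ 4"
      using E[of 3 4 7] by (simp add: brackets17_def extra)
    show "A $ 2 $ 2 = A $ 8 $ 8 + A $ 3 $ 3"
      using E[of 8 3 2] by (simp add: brackets17_def extra)
    show "A $ 15 $ 15 = A $ 3 $ 3 + A $ 9 $ 9"
      using E[of 3 9 15] by (simp add: brackets17_def extra)
    show "A $ 17 $ 17 = A $ 11 $ 11 + A $ 3 $ 3"
      using E[of 11 3 17] by (simp add: brackets17_def extra)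
    show "A $ 9 $ 9 = A $ 3 $ 3 + A $ 12 $ 12"
      using E[of 3 12 9] by (simp add: brackets17_def extra)
    show "A $ 4 $ 4 = A $ 8 $ 8 + A $ 5 $ 5"
      using E[of 8 5 4] by (simp add: brackets17_def extra)
    show "A $ 15 $ 15 = A $ 5 $ 5 + A $ 11 $ 11"
      using E[of 5 11 15] by (simp add: brackets17_def extra)
    show "A $ 15 $ 15 = A $ 12 $ 12 + A $ 6 $ 6"
      using E[of 12 6 15] by (simp add: brackets17_def extra)
    show "A $ 13 $ 13 = A $ 12 $ 12 + A $ 8 $ 8"
      using E[of 12 8 13] by (simp add: brackets17_def extra)
    show "A $ 14 $ 14 = A $ 13 $ 13 + A $ 8 $ 8"
      using E[of 13 8 14] by (simp add: brackets17_def extra)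
  qed
  \<comment> \<open>The unit is now the entry at index 8, since a_1 of weight 1 sits there.\<close>
  have d1: "A $ 1 $ 1 = A $ 8 $ 8 * -1"
    using brackets(1,2,4,5,7,8,11,13) by linarith
  have d3: "A $ 3 $ 3 = A $ 8 $ 8 * -3"
    using brackets(1,2,4,5,7,8,11,13) by linarith
  have d5: "A $ 5 $ 5 = A $ 8 $ 8 * -5"
    using brackets(1,2,3,4,5,7,8,11,12,13,16) by linarith
  have d12: "A $ 12 $ 12 = A $ 8 $ 8 * 5"
    using brackets(1,2,4,5,7,8,9,11,12,13,14) by linarith
  have d6: "A $ 6 $ 6 = A $ 8 $ 8 * -6"
    using brackets(1) d5 d1 by simp
  have d7: "A $ 7 $ 7 = A $ 8 $ 8 * -7"
    using brackets(2) d1 d6 by simp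
  have d11: "A $ 11 $ 11 = A $ 8 $ 8 * 4"
    using brackets(6) d12 d1 by simp
  have d2: "A $ 2 $ 2 = A $ 8 $ 8 * -2"
    using brackets(11) d3 by simp
  have d17: "A $ 17 $ 17 = A $ 8 $ 8 * 1"
    using brackets(13) d11 d3 by simp
  have d9: "A $ 9 $ 9 = A $ 8 $ 8 * 2"
    using brackets(14) d3 d12 by simp
  have d4: "A $ 4 $ 4 = A $ 8 $ 8 * -4"
    using brackets(15) d5 by simp
  have d15: "A $ 15 $ 15 = A $ 8 $ 8 * -1"
    using brackets(16) d5 d11 by simp
  have d13: "A $ 13 $ 13 = A $ 8 $ 8 * 6"
    using brackets(18) d12 by simp
  have d14: "A $ 14 $ 14 = A $ 8 $ 8 * 7"
    using brackets(19) d13 by simp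
  have d10: "A $ 10 $ 10 = A $ 8 $ 8 * 3"
    using brackets(5) d11 d1 by simp
  have d16: "A $ 16 $ 16 = A $ 8 $ 8 * 2"
    using brackets(4) d1 d10 by simp
  have "A $ i $ i = A $ 8 $ 8 * weight17 i" for i
  proof -
    have "\<forall>i. A $ i $ i = A $ 8 $ 8 * weight17 i"
      unfolding forall_17 weight17_simps
      using d1 d2 d3 d4 d5 d6 d7 d9 d10 d11 d12 d13 d14 d15 d16 d17 by simp
    then show ?thesis by blast
  qed
  moreover have "A $ i $ j = 0"
    if "i \<notin> lcs_support brackets17 1" "j \<notin> lcs_support brackets17 1" "i \<noteq> j" for i j
  proof -
    have gens: "\<forall>i. i \<notin> lcs_support brackets17 1 \<longrightarrow> i \<in> {1, 3, 5, 8, 12}"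
      unfolding forall_17 One_nat_def lcs_support_brackets17 by simp
    from gens that have "i \<in> {1, 3, 5, 8, 12}" "j \<in> {1, 3, 5, 8, 12}" by blast+
    with off \<open>i \<noteq> j\<close> show ?thesis by auto
  qed
  ultimately show ?thesis by blast
qed

lemma weights_brackets17: "\<forall>(i, j, k)\<in>set brackets17. weight17 k = weight17 i + weight17 j"
  by (simp add: brackets17_def weight17_simps)

lemma sum_weight17: "sum weight17 UNIV = 2"
  unfolding UNIV_17 by (simp add: weight17_simps)

lemma rank_brackets17:
  "lie_rank (nice_bracket brackets17) = 1" "pre_einstein_nonzero (nice_bracket brackets17)"
  using nice_rank_1[OF lie_algebra_brackets17 nice_brackets17 lcs_support_brackets17(5) weights_brackets17 _ Der_brackets17]
  by (simp_all add: sum_weight17)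

lemma diagonal_on_brackets17:
  "diagonal_on UNIV (diag weight17) [-1, -2, -3, -4, -5, -6, -7, 1, 2, 3, 4, 5, 6, 7, -1, 2, 1]"
  "diagonal_on (lie_center (nice_bracket brackets17)) (diag weight17) [-7, 7, -1, 1]"
proof -
  have "coord_subspace (set [1, 2, 3, 4, 5, 6, 7, 8, 9, 10, 11, 12, 13, 14, 15, 16, 17 :: 17]) = UNIV"
    by (simp add: coord_subspace_def forall_17)
  then show "diagonal_on UNIV (diag weight17) [-1, -2, -3, -4, -5, -6, -7, 1, 2, 3, 4, 5, 6, 7, -1, 2, 1]"
    using diagonal_on_coord_subspace[of "[1, 2, 3, 4, 5, 6, 7, 8, 9, 10, 11, 12, 13, 14, 15, 16, 17]" weight17] by (simp add: weight17_simps)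
  show "diagonal_on (lie_center (nice_bracket brackets17)) (diag weight17) [-7, 7, -1, 1]"
    using diagonal_on_coord_subspace[of "[7, 14, 15, 17]" weight17] by (simp add: lie_center_brackets17 weight17_simps)
qed

theorem proposition4p4:
  shows
    "(\<exists>(br :: 13 bracket) (D :: real ^ 13 ^ 13).
        lie_algebra br \<and> pre_einstein_nonzero br \<and>
        dim (UNIV :: (real ^ 13) set) = 13 \<and>
        step_nilpotent 5 br \<and>
        dim (lie_center br) = 3 \<and>
        lie_rank br = 1 \<and>
        D \<in> Der br \<and>
        diagonal_on UNIV D [1, 2, 3, 4, 5, 6, 7, -1, -2, -3, -4, -5, 1] \<and>
        diagonal_on (lie_center br) D [7, -5, 1])
     \<and>
     (\<exists>(br :: 17 bracket) (D :: real ^ 17 ^ 17).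
        lie_algebra br \<and> pre_einstein_nonzero br \<and>
        dim (UNIV :: (real ^ 17) set) = 17 \<and>
        step_nilpotent 5 br \<and>
        dim (lie_center br) = 4 \<and>
        lie_rank br = 1 \<and>
        D \<in> Der br \<and>
        diagonal_on UNIV D [-1, -2, -3, -4, -5, -6, -7, 1, 2, 3, 4, 5, 6, 7, -1, 2, 1] \<and>
        diagonal_on (lie_center br) D [-7, 7, -1, 1] \<and>
        trace D = 2)"
proof -
  let ?D13 = "diag weight13" and ?D17 = "diag weight17"
  \<comment> \<open>The center dimensions are the lengths of the eigenvalue lists.\<close>
  have "dim (lie_center (nice_bracket brackets13)) = 3" "dim (lie_center (nice_bracket brackets17)) = 4"
    using dim_diagonal_on[OF diagonal_on_brackets13(2)] dim_diagonal_on[OF diagonal_on_brackets17(2)] by simp_all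
  moreover have "dim (UNIV :: (real ^ 13) set) = 13" "dim (UNIV :: (real ^ 17) set) = 17"
    by simp_all
  moreover have "trace ?D17 = 2"
    by (simp add: trace_diag sum_weight17)
  ultimately show ?thesis
    using lie_algebra_brackets13 rank_brackets13 step_nilpotent_brackets13 diag_in_Der[OF weights_brackets13] diagonal_on_brackets13
      lie_algebra_brackets17 rank_brackets17 step_nilpotent_brackets17 diag_in_Der[OF weights_brackets17] diagonal_on_brackets17
    by blast
qed

end
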